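(* Let $I, K$ be two admissible ideals on a non-empty set $S$ and let $(P,\nu,* )$ be a PN space. Then for any function $f:S\to P$, $I_\nu^*$-convergence implies $I_\nu^K$-convergence; that is, if $f$ is $I_\nu^*$-convergent to $l\in P$, then $f$ is $I_\nu^K$-convergent to $l$.
   Context: A distribution function is a non-decreasing, left continuous function $F:\mathbb{R}\to\mathbb{R}_0^+=[0,\infty)$ with $F(-\infty)=0$ and $F(\infty)=1$ (understood as limits); $\Delta$ is the set of all of these. A $t$-norm is a binary operation $*:[0,1]\times[0,1]\to[0,1]$ that is commutative, associative, satisfies $a*1=a$, and satisfies $c*d\ge a*b$ whenever $c\ge a$, $d\ge b$. A probabilistic normed (PN) space is a triple $(P,\nu,* )$ with $P$ a real linear space, $*$ a $t$-norm and $\nu:P\to\Delta$, $x\mapsto\nu_x$, such that: (i) $\nu_x(0)=0$; (ii) $\nu_x(t)=1$ for all $t>0$ iff $x=0$; (iii) $\nu_{\alpha x}(t)=\nu_x(t/|\alpha|)$ for all $\alpha\in\mathbb{R}\setminus\{0\}$, $t>0$; (iv) $\nu_{x+y}(s+t)\ge\nu_x(s)*\nu_y(t)$ for all $x,y\in P$, $s,t\in\mathbb{R}$. An ideal on a non-empty set $S$ is a non-empty family $I\subseteq 2^S$ closed under finite unions and under taking subsets. It is non-trivial if $S\notin I$ and $I\ne\{\emptyset\}$. It is admissible if it is non-trivial and contains all singletons of $S$. $F(I)=\{E\subseteq S: S\setminus E\in I\}$. $\mathrm{Fin}(S)$ is the family of all finite subsets of $S$. For an ideal $K$ on $S$, a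 function $g:S\to P$ is $K_\nu$-convergent to $p\in P$ if for every $\epsilon>0$ and $t>0$ we have $\{s\in S:\nu_{g(s)-p}(t)\le 1-\epsilon\}\in K$; $\mathrm{Fin}(S)$-convergence with respect to $\nu$ is the case where this set is finite. A function $f:S\to P$ is $I_\nu^K$-convergent to $p$ if there is $M\in F(I)$ such that the function $g$ with $g(s)=f(s)$ for $s\in M$ and $g(s)=p$ for $s\notin M$ is $K_\nu$-convergent to $p$. It is $I_\nu^*$-convergent to $p$ if there is $M\in F(I)$ such that this $g$ is $\mathrm{Fin}(S)$-convergent to $p$ with respect to $\nu$. *)

theory Defs
  imports Complex_Main
begin

section \<open>Probabilistic normed spaces\<close>

definition distribution_functions :: "(real \<Rightarrow> real) set" where
  "distribution_functions =
     {F. (\<forall>t. 0 \<le> F t) \<and> mono F \<and> (\<forall>t. continuous (at_left t) F) \<and>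
         (F \<longlongrightarrow> 0) at_bot \<and> (F \<longlongrightarrow> 1) at_top}"

text \<open>A t-norm is an operation on the unit interval; it is represented by a function on the reals,
  whose values outside the unit interval are irrelevant.\<close>

locale t_norm =
  fixes T :: "real \<Rightarrow> real \<Rightarrow> real"
  assumes closed: "\<lbrakk>a \<in> {0..1}; b \<in> {0..1}\<rbrakk> \<Longrightarrow> T a b \<in> {0..1}"
    and commute: "\<lbrakk>a \<in> {0..1}; b \<in> {0..1}\<rbrakk> \<Longrightarrow> T a b = T b a"
    and assoc: "\<lbrakk>a \<in> {0..1}; b \<in> {0..1}; c \<in> {0..1}\<rbrakk> \<Longrightarrow> T (T a b) c = T a (T b c)"
    and right_neutral: "a \<in> {0..1} \<Longrightarrow> T a 1 = a"
    and mono: "\<lbrakk>a \<in> {0..1}; b \<in> {0..1}; c \<in> {0..1}; d \<in> {0..1}; a \<le> c; b \<le> d\<rbrakk>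
      \<Longrightarrow> T a b \<le> T c d"

locale pn_space = t_norm T
  for T :: "real \<Rightarrow> real \<Rightarrow> real" +
  fixes \<nu> :: "'p::real_vector \<Rightarrow> real \<Rightarrow> real"
  assumes distribution: "\<nu> x \<in> distribution_functions"
    and at_zero: "\<nu> x 0 = 0"
    and eq_one_iff: "(\<forall>t>0. \<nu> x t = 1) \<longleftrightarrow> x = 0"
    and scaleR: "\<lbrakk>\<alpha> \<noteq> 0; t > 0\<rbrakk> \<Longrightarrow> \<nu> (\<alpha> *\<^sub>R x) t = \<nu> x (t / \<bar>\<alpha>\<bar>)"
    and triangle: "\<nu> (x + y) (s + t) \<ge> T (\<nu> x s) (\<nu> y t)"


section \<open>Ideals of sets\<close>

definition ideal_on :: "'s set \<Rightarrow> 's set set \<Rightarrow> bool" where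
  "ideal_on S I \<longleftrightarrow>
     I \<subseteq> Pow S \<and> I \<noteq> {} \<and> (\<forall>A\<in>I. \<forall>B\<in>I. A \<union> B \<in> I) \<and> (\<forall>A\<in>I. \<forall>B. B \<subseteq> A \<longrightarrow> B \<in> I)"

definition nontrivial_ideal_on :: "'s set \<Rightarrow> 's set set \<Rightarrow> bool" where
  "nontrivial_ideal_on S I \<longleftrightarrow> ideal_on S I \<and> S \<notin> I \<and> I \<noteq> {{}}"

definition admissible_ideal_on :: "'s set \<Rightarrow> 's set set \<Rightarrow> bool" where
  "admissible_ideal_on S I \<longleftrightarrow> nontrivial_ideal_on S I \<and> (\<forall>s\<in>S. {s} \<in> I)"

definition dual_filter :: "'s set \<Rightarrow> 's set set \<Rightarrow> 's set set" where
  "dual_filter S I = {E. E \<subseteq> S \<and> S - E \<in> I}"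

definition Fin :: "'s set \<Rightarrow> 's set set" where
  "Fin S = {A. A \<subseteq> S \<and> finite A}"


section \<open>Convergence of functions along ideals\<close>

text \<open>A function from S to P is represented by a function on the whole type of which only the
  values on S are used.\<close>

definition ideal_convergent ::
  "'s set \<Rightarrow> ('p::real_vector \<Rightarrow> real \<Rightarrow> real) \<Rightarrow> 's set set \<Rightarrow> ('s \<Rightarrow> 'p) \<Rightarrow> 'p \<Rightarrow> bool" where
  "ideal_convergent S \<nu> K g p \<longleftrightarrow>
     (\<forall>\<epsilon>>0. \<forall>t>0. {s \<in> S. \<nu> (g s - p) t \<le> 1 - \<epsilon>} \<in> K)"

definition IK_convergent ::
  "'s set \<Rightarrow> ('p::real_vector \<Rightarrow> real \<Rightarrow> real) \<Rightarrow> 's set set \<Rightarrow> 's set set \<Rightarrow> ('s \<Rightarrow> 'p) \<Rightarrow> 'p \<Rightarrow> bool" where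
  "IK_convergent S \<nu> I K f p \<longleftrightarrow>
     (\<exists>M\<in>dual_filter S I. ideal_convergent S \<nu> K (\<lambda>s. if s \<in> M then f s else p) p)"

definition Istar_convergent ::
  "'s set \<Rightarrow> ('p::real_vector \<Rightarrow> real \<Rightarrow> real) \<Rightarrow> 's set set \<Rightarrow> ('s \<Rightarrow> 'p) \<Rightarrow> 'p \<Rightarrow> bool" where
  "Istar_convergent S \<nu> I f p \<longleftrightarrow>
     (\<exists>M\<in>dual_filter S I. ideal_convergent S \<nu> (Fin S) (\<lambda>s. if s \<in> M then f s else p) p)"

end

theory Submission
  imports Defs
begin

text \<open>Both notions ask for a set \<open>M\<close> in the dual filter of \<open>I\<close> and
  differ only in the ideal along which the modified function converges: \<open>Fin S\<close> or
  \<open>K\<close>. Admissibility puts all finite subsets of \<open>S\<close> into \<open>K\<close>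
  (\<open>Fin_subset_admissible_ideal\<close>), and convergence survives enlarging the ideal
  (\<open>ideal_convergent_mono\<close>).\<close>

lemma Fin_subset_admissible_ideal:
  assumes "admissible_ideal_on S K"
  shows "Fin S \<subseteq> K"
proof
  fix A assume "A \<in> Fin S"
  then have "finite A" and "A \<subseteq> S"
    by (auto simp: Fin_def)
  then show "A \<in> K"
  proof (induction A)
    case empty
    \<comment> \<open>\<open>K\<close> has some member, and the empty set is a subset of it.\<close>
    from assms show ?case
      by (auto simp: admissible_ideal_on_def nontrivial_ideal_on_def ideal_on_def)
  next
    case (insert x A)
    then have "{x} \<in> K" and "A \<in> K"
      using assms by (auto simp: admissible_ideal_on_def)
    then have "{x} \<union> A \<in> K"
      using assms unfolding admissible_ideal_on_def nontrivial_ideal_on_def ideal_on_def by blast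
    then show ?case by simp
  qed
qed

lemma ideal_convergent_mono:
  assumes "ideal_convergent S \<nu> J g p" and "J \<subseteq> K"
  shows "ideal_convergent S \<nu> K g p"
  using assms unfolding ideal_convergent_def by blast

theorem theorem4p4:
  fixes S :: "'s set" and I K :: "'s set set"
    and T :: "real \<Rightarrow> real \<Rightarrow> real" and \<nu> :: "'p::real_vector \<Rightarrow> real \<Rightarrow> real"
    and f :: "'s \<Rightarrow> 'p" and l :: 'p
  assumes "S \<noteq> {}"
    and "admissible_ideal_on S I" and "admissible_ideal_on S K"
    and "pn_space T \<nu>"
    and "Istar_convergent S \<nu> I f l"
  shows "IK_convergent S \<nu> I K f l"
  \<comment> \<open>The witness \<open>M\<close> is kept, so the modified function stays the
    same.\<close>
  using assms(5) ideal_convergent_mono[OF _ Fin_subset_admissible_ideal[OF assms(3)]]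
  unfolding Istar_convergent_def IK_convergent_def by blast

end
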